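(* Let $G$ be a graph and $F$ an arbitrary forest of $G$. Orient and order the $h$ edges not in $F$ as $e_1<e_2<\cdots<e_h$. For each cycle $C$ of $G$, orient $C$ so that it traverses, in its given direction, the smallest edge $e_i$ (in this order) contained in $C$. Then the resulting cycle orientation configuration is geometric.
   Context: Graphs are finite and connected, possibly with parallel edges but without loops; cycles are simple (every cycle contains some edge outside the forest $F$). Edges have reference orientations (for the $e_i$, take the chosen orientation); an oriented cycle $C$ is identified with $\sum_{e\in C}\operatorname{sign}(C,e)e$ in the real vector space $C_1(G,\mathbb{R})$ with orthonormal basis $E(G)$, where $\operatorname{sign}(C,e)=\pm1$ according as $C$ traverses $e$ along or against its reference orientation; $H_1(G,\mathbb{R})$ is the span of all cycles. A cycle orientation configuration assigns an orientation to each cycle; it is geometric if there exists $\mathbf{w}\in H_1(G,\mathbb{R})$ with $\langle\mathbf{w},C\rangle>0$ for every cycle $C$ oriented as in the configuration. (The associated map from spanning trees to break divisors — orient each edge $f\notin T$ as in its fundamental cycle in $T+f$ and put a chip at its head — is called an edge ordering map.) *)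

theory Defs
  imports "HOL-Analysis.Analysis" "Graph_Theory.Digraph_Component"
begin

text \<open>
  A multigraph with reference orientations is a \<^typ>\<open>('v, 'e) pre_digraph\<close>: the edges are the
  arcs, oriented from tail to head.  An oriented edge is a pair of an edge and a flag, with
  \<^const>\<open>True\<close> for its reference orientation and \<^const>\<open>False\<close> for the opposite one.
\<close>

definition oriented_edges_graph :: "('v, 'e) pre_digraph \<Rightarrow> ('v, 'e \<times> bool) pre_digraph" where
  "oriented_edges_graph G =
     \<lparr> verts = verts G,
       arcs = arcs G \<times> UNIV,
       tail = (\<lambda>(e, b). if b then tail G e else head G e),
       head = (\<lambda>(e, b). if b then head G e else tail G e) \<rparr>"

text \<open>
  Distinctness of the underlying edges only rules out walking along an edge and straight back;
  two parallel edges do form a cycle.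
\<close>

definition oriented_cycle :: "('v, 'e) pre_digraph \<Rightarrow> ('e \<times> bool) list \<Rightarrow> bool" where
  "oriented_cycle G p \<longleftrightarrow>
     pre_digraph.cycle (oriented_edges_graph G) p \<and> distinct (map fst p)"

definition edges_of :: "('e \<times> bool) list \<Rightarrow> 'e set" where
  "edges_of p = fst ` set p"

text \<open>A cycle without orientation is represented by its edge set, which determines it.\<close>

definition cycles :: "('v, 'e) pre_digraph \<Rightarrow> 'e set set" where
  "cycles G = {edges_of p | p. oriented_cycle G p}"

text \<open>
  The constant \<^const>\<open>forest\<close> of the library excludes directed cycles only.
\<close>

definition undirected_forest :: "('v, 'e) pre_digraph \<Rightarrow> bool" where
  "undirected_forest F \<longleftrightarrow> cycles F = {}"

definition sign :: "('e \<times> bool) list \<Rightarrow> 'e \<Rightarrow> real" where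
  "sign p e = (if (e, True) \<in> set p then 1 else - 1)"

text \<open>
  The chain space of \<open>G\<close> is the subspace of \<^typ>\<open>real ^ 'e\<close> with orthonormal basis
  \<open>axis e 1\<close> for \<open>e \<in> arcs G\<close>.  The finite type \<^typ>\<open>'e\<close> may contain elements that are not
  edges of \<open>G\<close>, so that graphs without edges are covered; these coordinates are zero for every
  element of \<open>H1 G\<close> below.
\<close>

definition cycle_chain :: "('e::finite \<times> bool) list \<Rightarrow> real ^ 'e" where
  "cycle_chain p = (\<Sum>e\<in>edges_of p. sign p e *\<^sub>R axis e 1)"

definition H1 :: "('v, 'e::finite) pre_digraph \<Rightarrow> (real ^ 'e) set" where
  "H1 G = span {cycle_chain p | p. oriented_cycle G p}"

text \<open>
  The walks around a cycle in a given direction differ by their starting point only and have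
  the same chain, so an orientation of a cycle is represented by a chain.
\<close>

definition orientations :: "('v, 'e::finite) pre_digraph \<Rightarrow> 'e set \<Rightarrow> (real ^ 'e) set" where
  "orientations G C = {cycle_chain p | p. oriented_cycle G p \<and> edges_of p = C}"

definition cycle_orientation_config ::
    "('v, 'e::finite) pre_digraph \<Rightarrow> ('e set \<Rightarrow> real ^ 'e) \<Rightarrow> bool" where
  "cycle_orientation_config G \<sigma> \<longleftrightarrow> (\<forall>C\<in>cycles G. \<sigma> C \<in> orientations G C)"

definition geometric :: "('v, 'e::finite) pre_digraph \<Rightarrow> ('e set \<Rightarrow> real ^ 'e) \<Rightarrow> bool" where
  "geometric G \<sigma> \<longleftrightarrow> (\<exists>w\<in>H1 G. \<forall>C\<in>cycles G. w \<bullet> \<sigma> C > 0)"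

text \<open>
  The list \<open>es\<close> enumerates, in increasing order, the edges outside the forest, each with its
  chosen direction.
\<close>

definition orders_and_orients :: "('e \<times> bool) list \<Rightarrow> 'e set \<Rightarrow> bool" where
  "orders_and_orients es A \<longleftrightarrow> distinct (map fst es) \<and> set (map fst es) = A"

definition smallest_edge :: "('e \<times> bool) list \<Rightarrow> 'e set \<Rightarrow> 'e \<times> bool" where
  "smallest_edge es C = es ! (LEAST i. i < length es \<and> fst (es ! i) \<in> C)"

definition edge_ordering_config ::
    "('v, 'e::finite) pre_digraph \<Rightarrow> ('e \<times> bool) list \<Rightarrow> 'e set \<Rightarrow> real ^ 'e" where
  "edge_ordering_config G es C =
     (THE x. \<exists>p. oriented_cycle G p \<and> edges_of p = C \<and> smallest_edge es C \<in> set p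
                 \<and> x = cycle_chain p)"

end

theory Submission
  imports Defs
begin

text \<open>
  Give the edge \<open>e\<^sub>i\<close>, in its chosen direction, the weight \<open>2\<^sup>-\<^sup>i\<close>.  The pairing of this chain with a
  cycle is dominated by the smallest \<open>e\<^sub>i\<close> on the cycle, so it is positive on every cycle of the
  configuration; its orthogonal projection to \<open>H\<^sub>1\<close> has the same pairings with cycles.

  The configuration is well defined because the difference of two cycles which have the same
  edges and share one oriented edge is a chain without boundary supported on a path, hence zero.
\<close>

section \<open>Rotation and reversal of cycles of oriented edges\<close>

lemma oriented_edges_graph_simps [simp]:
  "verts (oriented_edges_graph G) = verts G"
  "arcs (oriented_edges_graph G) = arcs G \<times> UNIV"
  "tail (oriented_edges_graph G) (e, b) = (if b then tail G e else head G e)"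
  "head (oriented_edges_graph G) (e, b) = (if b then head G e else tail G e)"
  by (simp_all add: oriented_edges_graph_def)

lemma head_apsnd_Not [simp]:
  "head (oriented_edges_graph G) (apsnd Not a) = tail (oriented_edges_graph G) a"
  by (cases a) simp

lemma tail_apsnd_Not [simp]:
  "tail (oriented_edges_graph G) (apsnd Not a) = head (oriented_edges_graph G) a"
  by (cases a) simp

lemma wf_digraph_oriented_edges_graph:
  "wf_digraph G \<Longrightarrow> wf_digraph (oriented_edges_graph G)"
  by (auto simp: wf_digraph_def)

lemma edges_of_Cons [simp]: "edges_of (a # p) = insert (fst a) (edges_of p)"
  by (simp add: edges_of_def)

text \<open>Cutting \<open>p = p1 @ a # p2\<close> open at \<open>a\<close> gives the path
  \<open>p2 @ p1\<close>. Its vertices are those of \<open>p\<close> without the first copy of the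
  repeated start vertex, in rotated order, hence distinct.\<close>

lemma cycle_rotate:
  assumes "wf_digraph G" "pre_digraph.cycle G p" "a \<in> set p"
  obtains q where "pre_digraph.apath G (head G a) q (tail G a)" "set p = insert a (set q)"
proof -
  interpret wf_digraph G by fact
  obtain u where u: "awalk u p u" "distinct (tl (awalk_verts u p))"
    using assms(2) by (auto simp: cycle_def)
  obtain p1 p2 where p: "p = p1 @ a # p2"
    using assms(3) by (auto simp: in_set_conv_decomp)
  have 1: "awalk u p1 (tail G a)" and 2: "awalk (head G a) p2 u"
    using u(1) unfolding p by (auto simp: awalk_Cons_iff)
  have 3: "awalk (head G a) (p2 @ p1) (tail G a)"
    using 1 2 by (rule awalk_appendI[rotated])
  have "awalk_verts u p = awalk_verts u p1 @ awalk_verts (head G a) p2"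
    using u(1) awalk_verts_append[of u p1 "a # p2" u] by (simp add: p)
  moreover have "awalk_verts (head G a) (p2 @ p1)
      = awalk_verts (head G a) p2 @ tl (awalk_verts u p1)"
    using awalk_verts_append[OF 3] 2 by simp
  ultimately have "distinct (awalk_verts (head G a) (p2 @ p1))"
    using u(2) by auto
  with 3 have "apath (head G a) (p2 @ p1) (tail G a)"
    by (simp add: apath_def)
  then show thesis by (rule that) (auto simp: p)
qed

text \<open>The vertex list is what carries distinctness over to reversed cycles. It is treated
  together with the walk property because the append rule for vertex lists needs the latter.\<close>

lemma awalk_rev:
  assumes "wf_digraph G" "pre_digraph.awalk (oriented_edges_graph G) u p v"
  shows "pre_digraph.awalk (oriented_edges_graph G) v (map (apsnd Not) (rev p)) u \<and>
    pre_digraph.awalk_verts (oriented_edges_graph G) v (map (apsnd Not) (rev p))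
      = rev (pre_digraph.awalk_verts (oriented_edges_graph G) u p)"
proof -
  interpret O: wf_digraph "oriented_edges_graph G"
    using assms(1) by (rule wf_digraph_oriented_edges_graph)
  show ?thesis using assms(2)
  proof (induction p arbitrary: u)
    case Nil
    then show ?case by (auto simp: O.awalk_Nil_iff)
  next
    case (Cons a p)
    let ?r = "map (apsnd Not) (rev p)"
    have a: "a \<in> arcs (oriented_edges_graph G)" "u = tail (oriented_edges_graph G) a"
      and p: "O.awalk (head (oriented_edges_graph G) a) p v"
      using Cons.prems by (auto simp: O.awalk_Cons_iff)
    note IH = Cons.IH[OF p]
    have "O.awalk (head (oriented_edges_graph G) a) [apsnd Not a] u"
      using a O.wellformed[OF a(1)] by (auto simp: O.awalk_simps)
    with IH have *: "O.awalk v (?r @ [apsnd Not a]) u"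
      by (blast intro: O.awalk_appendI)
    from O.awalk_verts_append[OF *] IH a(2)
    have "O.awalk_verts v (?r @ [apsnd Not a]) = rev (O.awalk_verts u (a # p))"
      by simp
    with * show ?case by simp
  qed
qed

lemma oriented_cycle_rev:
  assumes "wf_digraph G" "oriented_cycle G p"
  shows "oriented_cycle G (map (apsnd Not) (rev p))"
proof -
  interpret O: wf_digraph "oriented_edges_graph G"
    using assms(1) by (rule wf_digraph_oriented_edges_graph)
  obtain u where u: "O.awalk u p u" "distinct (tl (O.awalk_verts u p))" "p \<noteq> []"
    and d: "distinct (map fst p)"
    using assms(2) by (auto simp: oriented_cycle_def O.cycle_def)
  let ?vs = "O.awalk_verts u p"
  obtain vs where vs: "?vs = u # vs" "vs \<noteq> []" "last vs = u"
  proof (cases p)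
    case (Cons a q)
    then show ?thesis
      using that[of "O.awalk_verts (head (oriented_edges_graph G) a) q"] u(1)
      by (auto simp: O.awalk_Cons_iff)
  qed (use u(3) in simp)
  \<comment> \<open>\<open>cycle\<close> ignores the first entry of the vertex list; after reversal,
    the ignored entry is the former last one. Both are \<open>u\<close>, so dropping either leaves
    the same vertices.\<close>
  have "distinct (butlast ?vs)"
    using u(2) vs by (cases vs rule: rev_cases) auto
  then have "distinct (tl (rev ?vs))"
    by (metis butlast_rev distinct_rev rev_rev_ident)
  then have "O.cycle (map (apsnd Not) (rev p))"
    using awalk_rev[OF assms(1) u(1)] u(3) by (auto simp: O.cycle_def)
  moreover have "map fst (map (apsnd Not) (rev p)) = rev (map fst p)"
    by (simp add: rev_map)
  ultimately show ?thesis
    using d by (simp only: oriented_cycle_def distinct_rev)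
qed

lemma edges_of_rev: "edges_of (map (apsnd Not) (rev p)) = edges_of p"
  by (force simp: edges_of_def)

section \<open>Chains, boundaries and the uniqueness of orientations\<close>

lemma cycle_chain_nth: "cycle_chain p $ e = (if e \<in> edges_of p then sign p e else 0)"
proof -
  have "cycle_chain p $ e = (\<Sum>e'\<in>edges_of p. if e' = e then sign p e else 0)"
    unfolding cycle_chain_def 
    by (simp only: sum_component) (rule sum.cong, auto simp: axis_def)
  also have "\<dots> = (if e \<in> edges_of p then sign p e else 0)"
    by (subst sum.delta) (simp_all add: edges_of_def)
  finally show ?thesis .
qed

text \<open>Distinct underlying edges keep \<open>p\<close> from containing both directions of
  \<open>e\<close>, so the test for \<open>(e, True)\<close> in \<open>sign\<close> decides between
  them.\<close>

lemma sign_eq: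
  assumes "distinct (map fst p)" "(e, b) \<in> set p"
  shows "sign p e = (if b then 1 else - 1)"
proof -
  have "(e, \<not> b) \<notin> set p"
    using assms inj_onD[of fst "set p" "(e, b)" "(e, \<not> b)"] by (auto simp: distinct_map)
  with assms(2) show ?thesis by (cases b) (auto simp: sign_def)
qed

text \<open>The coefficient at \<open>v\<close> of the usual boundary map from 1-chains to 0-chains.
  Elements of the type that are not edges do no harm, since the chains used below vanish
  there.\<close>

definition boundary :: "('v, 'e::finite) pre_digraph \<Rightarrow> real ^ 'e \<Rightarrow> 'v \<Rightarrow> real" where
  "boundary G x v = (\<Sum>e\<in>UNIV. x $ e * (of_bool (head G e = v) - of_bool (tail G e = v)))"

lemma boundary_diff: "boundary G (x - y) v = boundary G x v - boundary G y v"
  by (simp add: boundary_def left_diff_distrib sum_subtractf)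

text \<open>Reversing an edge swaps head and tail, so reindexing by oriented edges absorbs the
  signs. The sum along the closed walk then telescopes to zero.\<close>

lemma boundary_cycle_chain:
  assumes "wf_digraph G" "oriented_cycle G p"
  shows "boundary G (cycle_chain p) v = 0"
proof -
  let ?O = "oriented_edges_graph G"
  interpret O: wf_digraph ?O
    using assms(1) by (rule wf_digraph_oriented_edges_graph)
  let ?f = "\<lambda>a. of_bool (head ?O a = v) - of_bool (tail ?O a = v) :: real"
  have d: "distinct (map fst p)" and "O.cycle p"
    using assms(2) by (auto simp: oriented_cycle_def)
  then obtain u where u: "O.cas u p u" by (auto simp: O.cycle_def O.awalk_def)
  have telescope: "O.cas s q t \<Longrightarrow> (\<Sum>a\<leftarrow>q. ?f a) = of_bool (t = v) - of_bool (s = v)" for s q t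
    by (induction q arbitrary: s) auto
  have "boundary G (cycle_chain p) v
      = (\<Sum>e\<in>edges_of p. sign p e * (of_bool (head G e = v) - of_bool (tail G e = v)))"
    unfolding boundary_def by (rule sum.mono_neutral_cong_right) (auto simp: cycle_chain_nth)
  also have "\<dots> = (\<Sum>a\<in>set p. ?f a)"
    unfolding edges_of_def using d
    by (subst sum.reindex) (auto simp: distinct_map sign_eq[OF d] intro!: sum.cong)
  also have "\<dots> = (\<Sum>a\<leftarrow>p. ?f a)"
    using d by (simp add: sum_list_distinct_conv_sum_set distinct_map)
  also have "\<dots> = 0"
    using telescope[OF u] by simp
  finally show ?thesis .
qed

text \<open>The first vertex of a path meets only the first edge of the path, so a vanishing
  boundary there forces that coordinate to be zero. Induction removes the edges one by one.\<close>

lemma boundary_free_on_apath_eq_0: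
  assumes "loopfree_digraph G" "pre_digraph.apath (oriented_edges_graph G) u p w"
    and "\<And>v. boundary G x v = 0" and "\<And>e. x $ e \<noteq> 0 \<Longrightarrow> e \<in> edges_of p"
  shows "x = 0"
proof -
  interpret loopfree_digraph G by fact
  let ?O = "oriented_edges_graph G"
  interpret O: wf_digraph ?O
    using wf_digraph_axioms by (rule wf_digraph_oriented_edges_graph)
  show ?thesis using assms(2,4)
  proof (induction p arbitrary: u)
    case Nil
    then show ?case by (auto simp: vec_eq_iff edges_of_def)
  next
    case (Cons a p)
    obtain e b where a: "a = (e, b)" by (cases a)
    have e: "e \<in> arcs G" and u: "tail ?O a = u" and p: "O.apath (head ?O a) p w"
      and nin: "u \<notin> set (O.awalk_verts (head ?O a) p)"
      using Cons.prems(1) by (auto simp: O.apath_Cons_iff a)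
    \<comment> \<open>Both ends of a later edge are vertices of the remaining path, which avoids
      \<open>u\<close>.\<close>
    have others: "head G e' \<noteq> u \<and> tail G e' \<noteq> u" if "e' \<in> edges_of p" for e'
    proof -
      obtain b' where "(e', b') \<in> set p" using \<open>e' \<in> edges_of p\<close> by (auto simp: edges_of_def)
      then have "head ?O (e', b') \<noteq> u" "tail ?O (e', b') \<noteq> u"
        using nin p O.awalk_verts_arc1[of _ p] O.awalk_verts_arc2[of _ p]
        unfolding O.apath_def by metis+
      then show ?thesis by (cases b') auto
    qed
    have "boundary G x u
        = (\<Sum>e'\<in>{e}. x $ e' * (of_bool (head G e' = u) - of_bool (tail G e' = u)))"
      unfolding boundary_def using Cons.prems(2) others
      by (intro sum.mono_neutral_right) (auto simp: a)
    \<comment> \<open>As \<open>e\<close> is not a loop, exactly one of its ends is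
      \<open>u\<close>, and its coefficient there is 1 or -1.\<close>
    then have "x $ e = 0"
      using assms(3)[of u] u no_loops[OF e] by (auto simp: a split: if_splits)
    with Cons.prems(2) have "\<And>e'. x $ e' \<noteq> 0 \<Longrightarrow> e' \<in> edges_of p"
      by (auto simp: a)
    with p show ?case by (rule Cons.IH)
  qed
qed

lemma cycle_chain_unique:
  assumes "loopfree_digraph G" "oriented_cycle G p" "oriented_cycle G q"
    and "edges_of p = edges_of q" "a \<in> set p" "a \<in> set q"
  shows "cycle_chain p = cycle_chain q"
proof -
  have wf: "wf_digraph G" using assms(1) by (simp add: loopfree_digraph_def)
  let ?x = "cycle_chain p - cycle_chain q"
  obtain r where r: "pre_digraph.apath (oriented_edges_graph G)
      (head (oriented_edges_graph G) a) r (tail (oriented_edges_graph G) a)"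
    and p: "set p = insert a (set r)"
    using cycle_rotate[OF wf_digraph_oriented_edges_graph[OF wf] _ assms(5)] assms(2)
    by (auto simp: oriented_cycle_def)
  have d: "distinct (map fst p)" "distinct (map fst q)"
    using assms(2,3) by (auto simp: oriented_cycle_def)
  \<comment> \<open>Both cycles traverse this edge in the same direction, so the difference lives on
    the path \<open>r\<close> left after removing \<open>a\<close>.\<close>
  have "?x $ fst a = 0"
    using sign_eq[OF d(1), of "fst a" "snd a"] sign_eq[OF d(2), of "fst a" "snd a"] assms(4-6)
    by (simp add: cycle_chain_nth)
  moreover have "edges_of p = insert (fst a) (edges_of r)"
    using p by (simp add: edges_of_def)
  ultimately have "e \<in> edges_of r" if "?x $ e \<noteq> 0" for e
    using that assms(4) by (auto simp: cycle_chain_nth split: if_splits)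
  moreover have "boundary G ?x v = 0" for v
    by (simp add: boundary_diff boundary_cycle_chain wf assms(2,3))
  ultimately have "?x = 0"
    using boundary_free_on_apath_eq_0[OF assms(1) r] by blast
  then show ?thesis by simp
qed

text \<open>This evaluates the definite description: a cycle through the edge in the wrong direction
  is reversed for existence, and \<open>cycle_chain_unique\<close> gives uniqueness.\<close>

lemma edge_ordering_config_eq:
  assumes "loopfree_digraph G" "C \<in> cycles G" "fst (smallest_edge es C) \<in> C"
  obtains p where "oriented_cycle G p" "edges_of p = C" "smallest_edge es C \<in> set p"
    "edge_ordering_config G es C = cycle_chain p"
proof -
  have wf: "wf_digraph G" using assms(1) by (simp add: loopfree_digraph_def)
  let ?a = "smallest_edge es C"
  obtain q where q: "oriented_cycle G q" "edges_of q = C"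
    using assms(2) by (auto simp: cycles_def)
  obtain b where b: "(fst ?a, b) \<in> set q"
    using assms(3) q(2) by (auto simp: edges_of_def)
  define p where "p = (if b = snd ?a then q else map (apsnd Not) (rev q))"
  have "?a \<in> set p"
  proof (cases "b = snd ?a")
    case False
    then have "?a = apsnd Not (fst ?a, b)" by (cases ?a) auto
    then have "?a \<in> apsnd Not ` set q" using b by (rule image_eqI)
    with False show ?thesis by (simp add: p_def)
  qed (use b in \<open>auto simp: p_def\<close>)
  moreover have "oriented_cycle G p" "edges_of p = C"
    using q oriented_cycle_rev[OF wf] by (auto simp: p_def edges_of_rev)
  moreover from calculation have "edge_ordering_config G es C = cycle_chain p"
    unfolding edge_ordering_config_def
    by (intro the_equality) (auto intro: cycle_chain_unique[OF assms(1)])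
  ultimately show thesis using that by blast
qed

section \<open>Cycles within a subgraph, and positivity of the weighted chain\<close>

lemma oriented_cycle_subgraph:
  assumes "subgraph F G" "oriented_cycle G p" "edges_of p \<subseteq> arcs F"
  shows "oriented_cycle F p"
proof -
  have F: "wf_digraph F" and G: "wf_digraph G" and eq: "tail F = tail G" "head F = head G"
    using assms(1) by (auto simp: subgraph_def compatible_def)
  interpret O: wf_digraph "oriented_edges_graph G"
    using G by (rule wf_digraph_oriented_edges_graph)
  interpret P: wf_digraph "oriented_edges_graph F"
    using F by (rule wf_digraph_oriented_edges_graph)
  \<comment> \<open>A subgraph has the same incidence functions, so only membership of the arcs and
    of the start vertex in \<open>F\<close> remains to be checked.\<close>
  have ends: "tail (oriented_edges_graph F) = tail (oriented_edges_graph G)"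
    "head (oriented_edges_graph F) = head (oriented_edges_graph G)"
    by (auto simp: fun_eq_iff eq)
  have cas: "P.cas u q v = O.cas u q v" for u q v
    by (induction q arbitrary: u) (auto simp: ends)
  have verts: "P.awalk_verts u q = O.awalk_verts u q" for u q
    by (induction q arbitrary: u) (auto simp: ends)
  obtain u where u: "O.awalk u p u" "distinct (tl (O.awalk_verts u p))" "p \<noteq> []"
    and d: "distinct (map fst p)"
    using assms(2) by (auto simp: oriented_cycle_def O.cycle_def)
  have p: "set p \<subseteq> arcs (oriented_edges_graph F)"
    using assms(3) by (auto simp: edges_of_def)
  moreover have "u \<in> verts F"
    using u(1,3) p P.wellformed by (cases p) (auto simp: O.awalk_Cons_iff ends[symmetric])
  ultimately have "P.awalk u p u"
    using u(1) by (simp add: P.awalk_def O.awalk_def cas)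
  then show ?thesis
    using u d by (auto simp: oriented_cycle_def P.cycle_def verts)
qed

text \<open>The leading term \<open>1 / 2 ^ k\<close> outweighs any finite number of later terms,
  whatever their signs.\<close>

lemma binary_weighted_sum_pos:
  fixes y :: "nat \<Rightarrow> real"
  assumes "k < n" "y k = 1" "\<And>i. i < k \<Longrightarrow> y i = 0" "\<And>i. \<bar>y i\<bar> \<le> 1"
  shows "(\<Sum>i<n. y i / 2 ^ i) > 0"
proof -
  have "Suc k \<le> n" using assms(1) by simp
  \<comment> \<open>A bound strong enough for induction: it is an equality at
    \<open>n = Suc k\<close>, and each further term costs at most \<open>1 / 2 ^ n\<close>, half of
    the bound.\<close>
  then have "(\<Sum>i<n. y i / 2 ^ i) \<ge> 2 / 2 ^ n"
  proof (induction n rule: dec_induct)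
    case base
    then show ?case using assms(2,3) by simp
  next
    case (step n)
    have "- (1 / 2 ^ n) \<le> y n / 2 ^ n"
      using assms(4)[of n] divide_right_mono[of "- 1" "y n" "2 ^ n"] by simp
    with step.IH show ?case by simp
  qed
  moreover have "(2 :: real) / 2 ^ n > 0" by simp
  ultimately show ?thesis by linarith
qed

theorem theorem4p1:
  fixes G F :: "('v, 'e::finite) pre_digraph"
    and es :: "('e \<times> bool) list"
  assumes "fin_digraph G" and "loopfree_digraph G" and "Digraph_Component.connected G"
    and "subgraph F G" and "undirected_forest F"
    and "orders_and_orients es (arcs G - arcs F)"
  shows "cycle_orientation_config G (edge_ordering_config G es)
       \<and> geometric G (edge_ordering_config G es)"
proof -
  interpret loopfree_digraph G by fact
  interpret O: wf_digraph "oriented_edges_graph G"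
    using wf_digraph_axioms by (rule wf_digraph_oriented_edges_graph)
  define k where "k C = (LEAST i. i < length es \<and> fst (es ! i) \<in> C)" for C
  have smallest: "smallest_edge es C = es ! k C" for C
    by (simp add: smallest_edge_def k_def)
  have k: "k C < length es \<and> fst (es ! k C) \<in> C" if C: "C \<in> cycles G" for C
  proof -
    obtain p where p: "oriented_cycle G p" "edges_of p = C"
      using C by (auto simp: cycles_def)
    have "C \<subseteq> arcs G"
      using p by (auto simp: oriented_cycle_def O.cycle_def O.awalk_def edges_of_def)
    \<comment> \<open>A cycle with all edges in \<open>F\<close> would be a cycle of the forest.
      Hence some listed edge lies on \<open>C\<close>, and the \<open>LEAST\<close> in
      \<open>k\<close> is attained.\<close>
    moreover have "\<not> C \<subseteq> arcs F"
      using oriented_cycle_subgraph[OF assms(4) p(1)] p(2) assms(5)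
      by (auto simp: undirected_forest_def cycles_def)
    ultimately obtain e where "e \<in> C" "e \<in> set (map fst es)"
      using assms(6) by (auto simp: orders_and_orients_def)
    then obtain i where "i < length es \<and> fst (es ! i) \<in> C"
      by (auto simp: in_set_conv_nth simp del: set_map)
    then show ?thesis unfolding k_def by (rule LeastI)
  qed
  have config: "\<exists>p. oriented_cycle G p \<and> edges_of p = C \<and> es ! k C \<in> set p \<and>
      edge_ordering_config G es C = cycle_chain p" if C: "C \<in> cycles G" for C
    using edge_ordering_config_eq[OF assms(2) C, of es] k[OF C] unfolding smallest by metis

  \<comment> \<open>List indices start at 0, so the weights are 1, 1/2, 1/4 and so on; the flag
    converts the chosen direction to the reference orientation.\<close>
  define u :: "real ^ 'e" where
    "u = (\<Sum>i<length es. ((if snd (es ! i) then 1 else - 1) / 2 ^ i) *\<^sub>R axis (fst (es ! i)) 1)"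
  have u_pos: "u \<bullet> edge_ordering_config G es C > 0" if C: "C \<in> cycles G" for C
  proof -
    obtain p where p: "oriented_cycle G p" "edges_of p = C" "es ! k C \<in> set p"
      "edge_ordering_config G es C = cycle_chain p"
      using config[OF C] by blast
    have d: "distinct (map fst p)" using p(1) by (simp add: oriented_cycle_def)
    \<comment> \<open>\<open>y i\<close> is 1 or -1 as the configured cycle follows or opposes the
      chosen direction of \<open>es ! i\<close>, and 0 off the cycle. It is 1 at \<open>k C\<close>
      by the choice of orientation and 0 before by minimality.\<close>
    define y where
      "y i = (if snd (es ! i) then 1 else - 1) * cycle_chain p $ fst (es ! i)" for i
    have "u \<bullet> edge_ordering_config G es C = (\<Sum>i<length es. y i / 2 ^ i)"
      by (simp add: u_def p(4) inner_sum_left inner_axis' y_def)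
    also have "\<dots> > 0"
    proof (rule binary_weighted_sum_pos)
      show "k C < length es" using k[OF C] by simp
      show "y (k C) = 1"
        using sign_eq[OF d, of "fst (es ! k C)" "snd (es ! k C)"] p(2,3) k[OF C]
        by (simp add: y_def cycle_chain_nth)
      show "y i = 0" if "i < k C" for i
        using not_less_Least[of i "\<lambda>i. i < length es \<and> fst (es ! i) \<in> C"] that k[OF C] p(2)
        by (auto simp: y_def cycle_chain_nth k_def)
      show "\<bar>y i\<bar> \<le> 1" for i
        by (simp add: y_def cycle_chain_nth sign_def)
    qed
    finally show ?thesis .
  qed
  \<comment> \<open>\<open>geometric\<close> asks for a witness in \<open>H1 G\<close>, where
    \<open>u\<close> itself need not lie.\<close>
  obtain w z where w: "w \<in> H1 G" and z: "\<And>x. x \<in> H1 G \<Longrightarrow> orthogonal z x" and uwz: "u = w + z"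
    unfolding H1_def by (rule orthogonal_subspace_decomp_exists) blast
  have "w \<bullet> edge_ordering_config G es C > 0" if C: "C \<in> cycles G" for C
  proof -
    have "edge_ordering_config G es C \<in> H1 G"
      using config[OF C] unfolding H1_def by (auto intro: span_base)
    then have "z \<bullet> edge_ordering_config G es C = 0"
      using z by (simp add: orthogonal_def)
    with u_pos[OF C] show ?thesis by (simp add: uwz inner_add_left)
  qed
  with w have "geometric G (edge_ordering_config G es)"
    by (auto simp: geometric_def)
  moreover have "cycle_orientation_config G (edge_ordering_config G es)"
    using config by (auto simp: cycle_orientation_config_def orientations_def)
  ultimately show ?thesis by blast
qed

end
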